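(* There is a uniformly computable sequence of sets $C_0,C_1,\ldots\subseteq\omega$ forming a $\delta$-Cauchy sequence such that every limit $C$ of this sequence satisfies $\emptyset'''\le_T C'$.
   Context: For $X\subseteq\omega$, $\rho_n(X)=|X\cap[0,n)|/n$ and $\delta(X,Y)=\limsup_n\rho_n(X\bigtriangleup Y)$. A sequence $A_0,A_1,\ldots$ is $\delta$-Cauchy if for every $k$ there is $m$ with $\delta(A_m,A_n)\le 2^{-k}$ for all $n>m$. A set $A$ is a limit of such a sequence if for every $k$ there is $m$ with $\delta(A_n,A)\le 2^{-k}$ for all $n>m$. *)

theory Defs
  imports "HOL-Library.Extended_Real" "HOL-Library.Nat_Bijection"
begin

section \<open>Relative computability\<close>

text \<open>
  Programs for the partial recursive functionals with a set oracle, in Kleene's style. All functions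
  are unary; several arguments are passed through the Cantor pairing \<open>prod_encode\<close>. Projections are
  obtained from \<open>Left\<close> and \<open>Right\<close>, and the identity is \<open>Pair Left Right\<close>.
\<close>

datatype prog =
    Zero | Succ | Left | Right | Query
  | Pair prog prog
  | Comp prog prog
  | Prec prog prog
  | Mu prog

text \<open>
  \<open>run X p\<close> is the partial function computed by \<open>p\<close> with oracle \<open>X\<close>; \<open>None\<close> means divergence.
  In \<open>Prec f g\<close> the step function \<open>g\<close> receives the parameter \<open>a\<close>, the counter \<open>i\<close> and the previous
  value \<open>v\<close>. In \<open>Mu f\<close> the search for the least zero only succeeds if \<open>f\<close> converges (to a nonzero
  value) at all smaller arguments.
\<close>

primrec run :: "nat set \<Rightarrow> prog \<Rightarrow> nat \<Rightarrow> nat option" where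
  "run X Zero = (\<lambda>x. Some 0)"
| "run X Succ = (\<lambda>x. Some (Suc x))"
| "run X Left = (\<lambda>x. Some (fst (prod_decode x)))"
| "run X Right = (\<lambda>x. Some (snd (prod_decode x)))"
| "run X Query = (\<lambda>x. Some (if x \<in> X then 1 else 0))"
| "run X (Pair f g) = (\<lambda>x.
     Option.bind (run X f x) (\<lambda>a. Option.bind (run X g x) (\<lambda>b. Some (prod_encode (a, b)))))"
| "run X (Comp f g) = (\<lambda>x. Option.bind (run X g x) (run X f))"
| "run X (Prec f g) = (\<lambda>x. case prod_decode x of (a, n) \<Rightarrow>
     rec_nat (run X f a)
       (\<lambda>i r. Option.bind r (\<lambda>v. run X g (prod_encode (a, prod_encode (i, v))))) n)"
| "run X (Mu f) = (\<lambda>x.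
     if \<exists>n. run X f (prod_encode (x, n)) = Some 0 \<and>
            (\<forall>m<n. \<exists>v. run X f (prod_encode (x, m)) = Some (Suc v))
     then Some (LEAST n. run X f (prod_encode (x, n)) = Some 0)
     else None)"

text \<open>A Goedel numbering of the programs; it is a bijection, see \<open>bij_index\<close> below.\<close>

primrec index :: "prog \<Rightarrow> nat" where
  "index Zero = 0"
| "index Succ = 1"
| "index Left = 2"
| "index Right = 3"
| "index Query = 4"
| "index (Pair f g) = 5 + 4 * prod_encode (index f, index g)"
| "index (Comp f g) = 6 + 4 * prod_encode (index f, index g)"
| "index (Prec f g) = 7 + 4 * prod_encode (index f, index g)"
| "index (Mu f) = 8 + 4 * index f"

lemma inj_index: "index p = index q \<Longrightarrow> p = q"
proof (induction p arbitrary: q)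
  case (Pair f g)
  then show ?case by (cases q) (auto, presburger+)
next
  case (Comp f g)
  then show ?case by (cases q) (auto, presburger+)
next
  case (Prec f g)
  then show ?case by (cases q) (auto, presburger+)
next
  case (Mu f)
  then show ?case by (cases q) (auto, presburger+)
qed (case_tac q; simp)+

lemma surj_index: "\<exists>p. index p = n"
proof (induction n rule: less_induct)
  case (less n)
  show ?case
  proof (cases "n < 5")
    case True
    then have "n = 0 \<or> n = 1 \<or> n = 2 \<or> n = 3 \<or> n = 4" by auto
    then show ?thesis by (metis index.simps(1-5))
  next
    case False
    define k where "k = (n - 5) div 4"
    obtain a b where ab: "k = prod_encode (a, b)"
      by (metis prod.exhaust prod_decode_inverse)
    have n: "n = 5 + 4 * k \<or> n = 6 + 4 * k \<or> n = 7 + 4 * k \<or> n = 8 + 4 * k"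
      using False unfolding k_def by presburger
    then have "k < n" by auto
    moreover have "a \<le> k" "b \<le> k"
      unfolding ab by (rule le_prod_encode_1, rule le_prod_encode_2)
    ultimately obtain f g h where "index f = a" "index g = b" "index h = k"
      using less.IH by (meson le_less_trans)
    then show ?thesis using n ab by (metis index.simps(6-9))
  qed
qed

lemma bij_index: "bij index"
  by (metis bijI' inj_index surj_index)

definition turing_le :: "nat set \<Rightarrow> nat set \<Rightarrow> bool" (infix "\<le>\<^sub>T" 50) where
  "A \<le>\<^sub>T B \<longleftrightarrow> (\<exists>p. \<forall>x. run B p x = Some (if x \<in> A then 1 else 0))"

definition jump :: "nat set \<Rightarrow> nat set" where
  "jump X = {index p | p. run X p (index p) \<noteq> None}"

text \<open>Computability without an oracle is computability relative to the empty set.\<close>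

definition uniformly_computable :: "(nat \<Rightarrow> nat set) \<Rightarrow> bool" where
  "uniformly_computable A \<longleftrightarrow>
     (\<exists>p. \<forall>n x. run {} p (prod_encode (n, x)) = Some (if x \<in> A n then 1 else 0))"

section \<open>The density pseudometric\<close>

text \<open>\<open>rho 0 X = 0\<close> by the convention for division by zero; this does not affect \<open>delta\<close>.\<close>

definition rho :: "nat \<Rightarrow> nat set \<Rightarrow> real" where
  "rho n X = real (card (X \<inter> {0..<n})) / real n"

text \<open>Extended reals are used only because \<open>limsup\<close> needs a complete lattice; the value always
  lies in the unit interval.\<close>

definition delta :: "nat set \<Rightarrow> nat set \<Rightarrow> ereal" where
  "delta X Y = limsup (\<lambda>n. ereal (rho n (sym_diff X Y)))"

definition delta_Cauchy :: "(nat \<Rightarrow> nat set) \<Rightarrow> bool" where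
  "delta_Cauchy A \<longleftrightarrow> (\<forall>k::nat. \<exists>m. \<forall>n>m. delta (A m) (A n) \<le> ereal (1 / 2 ^ k))"

definition delta_limit :: "(nat \<Rightarrow> nat set) \<Rightarrow> nat set \<Rightarrow> bool" where
  "delta_limit A L \<longleftrightarrow> (\<forall>k::nat. \<exists>m. \<forall>n>m. delta (A n) L \<le> ereal (1 / 2 ^ k))"

end

theory Submission
  imports Defs
begin

text \<open>
  Given a limit \<open>L\<close>, the jump of \<open>L\<close> can search for an \<open>n\<close> such that \<open>C n\<close> is within a prescribed
  distance of \<open>L\<close>, because ``from some point on the partial densities are small'' is \<open>\<Sigma>\<^sub>2\<close> in \<open>L\<close>. The
  sequence is built so that every such \<open>n\<close> must be large, at a rate that encodes the third jump.

  Split the positive numbers into columns of density \<open>2 ^ - (i + 1)\<close> and cut each column into its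
  intersections with the dyadic intervals \<open>[2 ^ j, 2 ^ (j + 1))\<close>. In column \<open>2 * k\<close>, \<open>C n\<close> contains the
  \<open>j\<close>-th block if \<open>G k n j\<close>, where the sets \<open>{j. G k n j}\<close> stabilise modulo finite sets as \<open>n\<close> grows, to an
  infinite set if \<open>k\<close> lies in the third jump, and are all finite otherwise. If \<open>C n\<close> is close enough to
  \<open>L\<close>, then \<open>k\<close> lies in the third jump iff \<open>{j. G k n j}\<close> is infinite. This remaining \<open>\<Pi>\<^sub>2\<close> question is
  answered in the same way: the odd column with index \<open>(k, n)\<close> makes the jump of \<open>L\<close> find an \<open>m\<close> such
  that \<open>{j. G k n j}\<close> is finite iff it has no element \<open>\<ge> m\<close>.
\<close>

section \<open>Closure properties of relative computability\<close>

definition pair :: "nat \<Rightarrow> nat \<Rightarrow> nat" where "pair a b = prod_encode (a, b)"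
definition pi1 :: "nat \<Rightarrow> nat" where "pi1 z = fst (prod_decode z)"
definition pi2 :: "nat \<Rightarrow> nat" where "pi2 z = snd (prod_decode z)"

lemma pi_pair [simp]: "pi1 (pair a b) = a" "pi2 (pair a b) = b" "pair (pi1 z) (pi2 z) = z"
  by (simp_all add: pair_def pi1_def pi2_def)

lemma pair_eq_iff [simp]: "pair a b = pair c d \<longleftrightarrow> a = c \<and> b = d"
  by (simp add: pair_def)

lemma le_pair: "a \<le> pair a b" "b \<le> pair a b"
  by (simp_all add: pair_def le_prod_encode_1 le_prod_encode_2)

definition computable :: "nat set \<Rightarrow> (nat \<Rightarrow> nat) \<Rightarrow> bool" where
  "computable X f \<longleftrightarrow> (\<exists>p. \<forall>x. run X p x = Some (f x))"

definition decidable :: "nat set \<Rightarrow> (nat \<Rightarrow> bool) \<Rightarrow> bool" where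
  "decidable X P \<longleftrightarrow> computable X (\<lambda>x. if P x then 1 else 0)"

lemma computableI: "(\<And>x. run X p x = Some (f x)) \<Longrightarrow> computable X f"
  by (auto simp: computable_def)

lemma computableE:
  assumes "computable X f" obtains p where "\<And>x. run X p x = Some (f x)"
  using assms by (auto simp: computable_def)

lemma computable_id: "computable X (\<lambda>x. x)"
  by (rule computableI[of _ "Pair Left Right"]) simp

lemma computable_comp:
  assumes "computable X f" "computable X g" shows "computable X (\<lambda>x. f (g x))"
proof -
  obtain p q where "\<And>x. run X p x = Some (f x)" "\<And>x. run X q x = Some (g x)"
    using assms by (auto simp: computable_def)
  then show ?thesis by (intro computableI[of _ "Comp p q"]) simp
qed

lemma computable_Suc: "computable X f \<Longrightarrow> computable X (\<lambda>x. Suc (f x))"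
  by (rule computable_comp[of _ Suc]) (rule computableI[of _ Succ], simp)

lemma computable_const: "computable X (\<lambda>x. c)"
  by (induction c) (rule computableI[of _ Zero], simp, rule computable_Suc)

lemma computable_pi1: "computable X f \<Longrightarrow> computable X (\<lambda>x. pi1 (f x))"
  by (rule computable_comp[of _ pi1]) (rule computableI[of _ Left], simp add: pi1_def)

lemma computable_pi2: "computable X f \<Longrightarrow> computable X (\<lambda>x. pi2 (f x))"
  by (rule computable_comp[of _ pi2]) (rule computableI[of _ Right], simp add: pi2_def)

lemma computable_pair:
  assumes "computable X f" "computable X g" shows "computable X (\<lambda>x. pair (f x) (g x))"
proof -
  obtain p q where "\<And>x. run X p x = Some (f x)" "\<And>x. run X q x = Some (g x)"
    using assms by (auto simp: computable_def)
  then show ?thesis by (intro computableI[of _ "Pair p q"]) (simp add: pair_def)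
qed

text \<open>\<open>Prec\<close> is run with the whole input \<open>x\<close> as its parameter, so
  the step may depend on \<open>x\<close> besides the counter and the previous value.\<close>

lemma computable_rec:
  assumes "computable X f" "computable X (\<lambda>z. g (pi1 z) (pi1 (pi2 z)) (pi2 (pi2 z)))" "computable X h"
  shows "computable X (\<lambda>x. rec_nat (f x) (\<lambda>i v. g x i v) (h x))"
proof -
  obtain p q where p: "\<And>x. run X p x = Some (f x)"
    and q: "\<And>z. run X q z = Some (g (pi1 z) (pi1 (pi2 z)) (pi2 (pi2 z)))"
    using assms by (auto simp: computable_def)
  have "run X q (pair x (pair i v)) = Some (g x i v)" for x i v by (simp add: q)
  then have "run X (Prec p q) (pair x n) = Some (rec_nat (f x) (\<lambda>i v. g x i v) n)" for x n
    by (induction n) (simp_all add: pair_def p)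
  from this[of "pi1 z" "pi2 z" for z]
  have "computable X (\<lambda>z. rec_nat (f (pi1 z)) (\<lambda>i v. g (pi1 z) i v) (pi2 z))"
    by (intro computableI[of _ "Prec p q"]) (simp only: pi_pair)
  from computable_comp[OF this computable_pair[OF computable_id assms(3)]] show ?thesis by simp
qed

lemma computable_if:
  assumes "decidable X P" "computable X f" "computable X g"
  shows "computable X (\<lambda>x. if P x then f x else g x)"
proof -
  \<comment> \<open>The truth value is the recursion length: zero steps leave \<open>g x\<close>,
    one step returns \<open>f x\<close>.\<close>
  have "computable X (\<lambda>x. rec_nat (g x) (\<lambda>i v. f x) (if P x then 1 else 0))"
    by (intro computable_rec assms(3) assms(1)[unfolded decidable_def]
        computable_comp[OF assms(2)] computable_pi1 computable_id)
  then show ?thesis by (rule back_subst[of "computable X"]) auto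
qed

lemmas computable_base = computable_id computable_const computable_Suc computable_pi1
  computable_pi2 computable_pair

lemma computable_add:
  assumes "computable X f" "computable X g" shows "computable X (\<lambda>x. f x + g x)"
proof -
  have "computable X (\<lambda>x. rec_nat (f x) (\<lambda>i v. Suc v) (g x))"
    by (intro computable_rec assms computable_base)
  moreover have "rec_nat a (\<lambda>i v. Suc v) b = a + b" for a b by (induction b) auto
  ultimately show ?thesis by simp
qed

lemma computable_mult:
  assumes "computable X f" "computable X g" shows "computable X (\<lambda>x. f x * g x)"
proof -
  have "computable X (\<lambda>x. rec_nat 0 (\<lambda>i v. v + f x) (g x))"
    by (intro computable_rec assms computable_base computable_add computable_comp[OF assms(1)])
  moreover have "rec_nat 0 (\<lambda>i v. v + a) b = a * b" for a b :: nat by (induction b) auto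
  ultimately show ?thesis by simp
qed

lemma computable_power:
  assumes "computable X f" "computable X g" shows "computable X (\<lambda>x. f x ^ g x)"
proof -
  have "computable X (\<lambda>x. rec_nat 1 (\<lambda>i v. f x * v) (g x))"
    by (intro computable_rec assms computable_base computable_mult computable_comp[OF assms(1)])
  moreover have "rec_nat 1 (\<lambda>i v. a * v) b = a ^ b" for a b :: nat by (induction b) auto
  ultimately show ?thesis by simp
qed

lemma computable_diff:
  assumes "computable X f" "computable X g" shows "computable X (\<lambda>x. f x - g x)"
proof -
  \<comment> \<open>A recursion that returns its counter yields the predecessor; iterating it gives
    truncated subtraction.\<close>
  have pred: "computable X (\<lambda>x. rec_nat 0 (\<lambda>i v. i) x)"
    by (intro computable_rec computable_base)
  have "computable X (\<lambda>x. rec_nat (f x) (\<lambda>i v. rec_nat 0 (\<lambda>i v. i) v) (g x))"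
    by (intro computable_rec assms computable_base computable_comp[OF pred])
  moreover have "rec_nat 0 (\<lambda>i v. i) c = c - 1" for c :: nat by (cases c) auto
  moreover have "rec_nat a (\<lambda>i v. v - 1) b = a - b" for a b :: nat by (induction b) auto
  ultimately show ?thesis by simp
qed

section \<open>Decidable predicates and bounded quantifiers\<close>

lemma decidable_comp: "decidable X P \<Longrightarrow> computable X f \<Longrightarrow> decidable X (\<lambda>x. P (f x))"
  unfolding decidable_def by (rule computable_comp)

lemma decidable_less:
  assumes "computable X f" "computable X g" shows "decidable X (\<lambda>x. f x < g x)"
proof -
  have "computable X (\<lambda>x. 1 - (1 - (g x - f x)))"
    by (intro computable_diff computable_base assms)
  then show ?thesis unfolding decidable_def by (rule back_subst[of "computable X"]) auto
qed

lemma decidable_not: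
  assumes "decidable X P" shows "decidable X (\<lambda>x. \<not> P x)"
proof -
  have "computable X (\<lambda>x. if P x then 0 else 1)"
    by (rule computable_if[OF assms computable_const computable_const])
  then show ?thesis unfolding decidable_def by (rule back_subst[of "computable X"]) auto
qed

lemma decidable_conj:
  assumes "decidable X P" "decidable X Q" shows "decidable X (\<lambda>x. P x \<and> Q x)"
proof -
  have "computable X (\<lambda>x. if P x then (if Q x then 1 else 0) else 0)"
    by (intro computable_if computable_base assms)
  then show ?thesis unfolding decidable_def by (rule back_subst[of "computable X"]) auto
qed

lemma decidable_disj:
  "decidable X P \<Longrightarrow> decidable X Q \<Longrightarrow> decidable X (\<lambda>x. P x \<or> Q x)"
  using decidable_not[OF decidable_conj[OF decidable_not decidable_not]] by simp

lemma decidable_imp: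
  "decidable X P \<Longrightarrow> decidable X Q \<Longrightarrow> decidable X (\<lambda>x. P x \<longrightarrow> Q x)"
  using decidable_disj[OF decidable_not, of X P Q] by (simp only: imp_conv_disj)

lemma decidable_le:
  "computable X f \<Longrightarrow> computable X g \<Longrightarrow> decidable X (\<lambda>x. f x \<le> g x)"
  using decidable_not[OF decidable_less, of X g f] by (simp add: not_less)

lemma decidable_eq:
  "computable X f \<Longrightarrow> computable X g \<Longrightarrow> decidable X (\<lambda>x. f x = g x)"
  using decidable_conj[OF decidable_le decidable_le, of X f g g f] by (simp add: eq_iff)

lemma decidable_oracle: "computable X f \<Longrightarrow> decidable X (\<lambda>x. f x \<in> X)"
  by (rule decidable_comp[of _ "\<lambda>x. x \<in> X"])
    (auto simp: decidable_def intro: computableI[of _ Query])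

text \<open>Counting serves twice: bounded quantifiers are reduced to it, and densities are computed
  with it.\<close>

lemma computable_card:
  assumes "decidable X (\<lambda>z. P (pi1 z) (pi2 z))" "computable X f"
  shows "computable X (\<lambda>x. card {y. y < f x \<and> P x y})"
proof -
  have P: "decidable X (\<lambda>z. P (pi1 z) (pi1 (pi2 z)))"
    using decidable_comp[OF assms(1), of "\<lambda>z. pair (pi1 z) (pi1 (pi2 z))"]
    by (simp add: computable_base)
  have "computable X (\<lambda>x. rec_nat 0 (\<lambda>i v. if P x i then Suc v else v) (f x))"
    by (intro computable_rec assms computable_base computable_if P)
  moreover have "rec_nat 0 (\<lambda>i v. if P x i then Suc v else v) n = card {y. y < n \<and> P x y}" for x n
  proof (induction n)
    case (Suc n)
    have "{y. y < Suc n \<and> P x y} = (if P x n then insert n else id) {y. y < n \<and> P x y}"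
      by (auto simp: less_Suc_eq)
    then show ?case using Suc by auto
  qed auto
  ultimately show ?thesis by simp
qed

lemma decidable_ex_less:
  assumes "computable X f" "decidable X (\<lambda>z. P (pi1 z) (pi2 z))"
  shows "decidable X (\<lambda>x. \<exists>y<f x. P x y)"
proof -
  have "decidable X (\<lambda>x. 0 < card {y. y < f x \<and> P x y})"
    by (intro decidable_less computable_const computable_card assms)
  then show ?thesis by (simp add: card_gt_0_iff)
qed

lemma decidable_all_less:
  "computable X f \<Longrightarrow> decidable X (\<lambda>z. P (pi1 z) (pi2 z)) \<Longrightarrow> decidable X (\<lambda>x. \<forall>y<f x. P x y)"
  using decidable_not[OF decidable_ex_less[OF _ decidable_not], of X f P] by simp

lemma decidable_ex_le:
  "computable X f \<Longrightarrow> decidable X (\<lambda>z. P (pi1 z) (pi2 z)) \<Longrightarrow> decidable X (\<lambda>x. \<exists>y\<le>f x. P x y)"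
  using decidable_ex_less[OF computable_Suc, of X f P] by (simp add: less_Suc_eq_le)

lemma decidable_all_le:
  "computable X f \<Longrightarrow> decidable X (\<lambda>z. P (pi1 z) (pi2 z)) \<Longrightarrow> decidable X (\<lambda>x. \<forall>y\<le>f x. P x y)"
  using decidable_all_less[OF computable_Suc, of X f P] by (simp add: less_Suc_eq_le)

lemmas computable_intros = computable_base computable_add computable_mult computable_power
  computable_if decidable_less decidable_le decidable_eq decidable_not decidable_conj
  decidable_disj decidable_imp decidable_ex_less decidable_all_less decidable_ex_le
  decidable_all_le

text \<open>Numbers code finite sets by binary digits. A digit is tested by a bounded search for
  quotient and remainder, which uses only the arithmetic established above.\<close>

lemma decidable_set_decode:
  assumes "computable X f" "computable X g"
  shows "decidable X (\<lambda>x. f x \<in> set_decode (g x))"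
proof -
  have "n \<in> set_decode w \<longleftrightarrow> (\<exists>q\<le>w. \<exists>r\<le>w. r < 2 ^ n \<and> w = (2 * q + 1) * 2 ^ n + r)" for n w
  proof
    assume "n \<in> set_decode w"
    then obtain q where q: "w div 2 ^ n = 2 * q + 1" by (auto simp: set_decode_def elim: oddE)
    have "w = (2 * q + 1) * 2 ^ n + w mod 2 ^ n" by (metis div_mult_mod_eq q)
    moreover have "q \<le> w" using q div_le_dividend[of w "2 ^ n"] by linarith
    ultimately show "\<exists>q\<le>w. \<exists>r\<le>w. r < 2 ^ n \<and> w = (2 * q + 1) * 2 ^ n + r"
      by (metis mod_less_divisor mod_less_eq_dividend zero_less_numeral zero_less_power)
  next
    assume "\<exists>q\<le>w. \<exists>r\<le>w. r < 2 ^ n \<and> w = (2 * q + 1) * 2 ^ n + r"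
    then obtain q r where "r < 2 ^ n" "w = (2 * q + 1) * 2 ^ n + r" by blast
    then have "w div 2 ^ n = 2 * q + 1" by (simp only: div_mult_self3 div_less)
    then show "n \<in> set_decode w" by (simp add: set_decode_def)
  qed
  moreover have "decidable X (\<lambda>z. \<exists>q\<le>pi2 z. \<exists>r\<le>pi2 z. r < 2 ^ pi1 z \<and> pi2 z = (2 * q + 1) * 2 ^ pi1 z + r)"
    by (intro computable_intros)
  ultimately have "decidable X (\<lambda>z. pi1 z \<in> set_decode (pi2 z))" by simp
  from decidable_comp[OF this computable_pair[OF assms]] show ?thesis by simp
qed

section \<open>Unbounded search, the jump and change of oracle\<close>

lemma computable_Least:
  assumes "decidable X (\<lambda>z. P (pi1 z) (pi2 z))" "\<And>x. \<exists>y. P x y"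
  shows "computable X (\<lambda>x. LEAST y. P x y)"
proof -
  have "computable X (\<lambda>z. if P (pi1 z) (pi2 z) then 0 else 1)"
    by (rule computable_if[OF assms(1) computable_const computable_const])
  then obtain p where "\<And>z. run X p z = Some (if P (pi1 z) (pi2 z) then 0 else 1)"
    by (rule computableE) blast
  then have "run X p (pair x y) = Some (if P x y then 0 else 1)" for x y by simp
  then have p: "run X p (prod_encode (x, y)) = Some (if P x y then 0 else 1)" for x y
    by (simp add: pair_def)
  have "run X (Mu p) x = Some (LEAST y. P x y)" for x
  proof -
    have "P x (LEAST y. P x y)" "\<forall>m<(LEAST y. P x y). \<not> P x m"
      using LeastI_ex[OF assms(2)] not_less_Least[of _ "P x"] by blast+
    moreover have "run X p (prod_encode (x, y)) = Some 0 \<longleftrightarrow> P x y"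
      "(\<exists>v. run X p (prod_encode (x, y)) = Some (Suc v)) \<longleftrightarrow> \<not> P x y" for y
      by (simp_all add: p)
    ultimately show ?thesis unfolding run.simps by (simp only:) metis
  qed
  then show ?thesis by (rule computableI)
qed

text \<open>Here the search may diverge: an existential property becomes the domain of a program, a
  form that the jump can test.\<close>

lemma run_Mu_ne_None:
  assumes "decidable X (\<lambda>z. P (pi1 z) (pi2 z))"
  obtains p where "\<And>x. run X p x \<noteq> None \<longleftrightarrow> (\<exists>y. P x y)"
proof -
  have "computable X (\<lambda>z. if P (pi1 z) (pi2 z) then 0 else 1)"
    by (rule computable_if[OF assms(1) computable_const computable_const])
  then obtain p where "\<And>z. run X p z = Some (if P (pi1 z) (pi2 z) then 0 else 1)"
    by (rule computableE) blast
  then have "run X p (pair x y) = Some (if P x y then 0 else 1)" for x y by simp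
  then have p: "run X p (prod_encode (x, y)) = Some (if P x y then 0 else 1)" for x y
    by (simp add: pair_def)
  have "run X (Mu p) x \<noteq> None \<longleftrightarrow> (\<exists>y. P x y)" for x
  proof
    assume "\<exists>y. P x y"
    then have "P x (LEAST y. P x y)" "\<forall>m<(LEAST y. P x y). \<not> P x m"
      using LeastI_ex[of "P x"] not_less_Least[of _ "P x"] by blast+
    moreover have "run X p (prod_encode (x, y)) = Some 0 \<longleftrightarrow> P x y"
      "(\<exists>v. run X p (prod_encode (x, y)) = Some (Suc v)) \<longleftrightarrow> \<not> P x y" for y
      by (simp_all add: p)
    ultimately show "run X (Mu p) x \<noteq> None" unfolding run.simps by (simp only:) (metis option.distinct(1))
  qed (auto simp: p split: if_splits)
  then show ?thesis by (rule that)
qed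

lemma index_in_jump: "index p \<in> jump X \<longleftrightarrow> run X p (index p) \<noteq> None"
  unfolding jump_def using inj_index by blast

text \<open>The s-m-n theorem is explicit here: plugging \<open>x\<close> into \<open>p\<close> gives the program
  \<open>Comp p (Succ o ... o Succ o Zero)\<close>, whose index is primitive recursive in \<open>x\<close>.\<close>

lemma decidable_jump_ex:
  assumes "decidable X (\<lambda>z. P (pi1 z) (pi2 z))"
  shows "decidable (jump X) (\<lambda>x. \<exists>y. P x y)"
proof -
  obtain p where p: "\<And>x. run X p x \<noteq> None \<longleftrightarrow> (\<exists>y. P x y)"
    using run_Mu_ne_None[OF assms] by blast
  define c where "c = rec_nat Zero (\<lambda>_ q. Comp Succ q)"
  have c: "run X (c x) y = Some x" for x y by (induction x) (simp_all add: c_def)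
  define s where "s x = 6 + 4 * pair (index p) (rec_nat 0 (\<lambda>i v. 6 + 4 * pair 1 v) x)" for x
  have "rec_nat 0 (\<lambda>i v. 6 + 4 * pair 1 v) x = index (c x)" for x
    by (induction x) (simp_all add: c_def pair_def)
  then have s: "s x = index (Comp p (c x))" for x by (simp add: s_def pair_def)
  have "s x \<in> jump X \<longleftrightarrow> (\<exists>y. P x y)" for x
  proof -
    have "s x \<in> jump X \<longleftrightarrow> run X (Comp p (c x)) (s x) \<noteq> None"
      unfolding s by (rule index_in_jump)
    also have "\<dots> \<longleftrightarrow> (\<exists>y. P x y)" by (simp add: c p flip: not_None_eq)
    finally show ?thesis .
  qed
  moreover have "computable (jump X) s"
    unfolding s_def by (intro computable_intros computable_rec)
  ultimately show ?thesis using decidable_oracle[of "jump X" s] by simp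
qed

lemma decidable_jump_all:
  "decidable X (\<lambda>z. P (pi1 z) (pi2 z)) \<Longrightarrow> decidable (jump X) (\<lambda>x. \<forall>y. P x y)"
  using decidable_not[OF decidable_jump_ex[OF decidable_not], of X P] by simp

text \<open>Every \<open>Query\<close> in \<open>p\<close> is replaced by a program deciding
  \<open>X\<close> from \<open>Y\<close>; all other constructors are kept.\<close>

lemma run_change_oracle:
  assumes "decidable Y (\<lambda>x. x \<in> X)"
  shows "\<exists>q. run Y q = run X p"
proof (induction p)
  case Query
  then show ?case using assms by (auto simp: decidable_def computable_def fun_eq_iff)
next
  case (Pair f g)
  then obtain f' g' where "run Y f' = run X f" "run Y g' = run X g" by blast
  then have "run Y (Pair f' g') = run X (Pair f g)" by simp
  then show ?case ..
next
  case (Comp f g)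
  then obtain f' g' where "run Y f' = run X f" "run Y g' = run X g" by blast
  then have "run Y (Comp f' g') = run X (Comp f g)" by simp
  then show ?case ..
next
  case (Prec f g)
  then obtain f' g' where "run Y f' = run X f" "run Y g' = run X g" by blast
  then have "run Y (Prec f' g') = run X (Prec f g)" by simp
  then show ?case ..
next
  case (Mu f)
  then obtain f' where "run Y f' = run X f" by blast
  then have "run Y (Mu f') = run X (Mu f)" by (simp only: run.simps)
  then show ?case ..
qed (metis run.simps)+

lemma decidable_change_oracle:
  "decidable Y (\<lambda>x. x \<in> X) \<Longrightarrow> decidable X P \<Longrightarrow> decidable Y P"
  using run_change_oracle[of Y X] unfolding decidable_def[of _ P] computable_def by metis

lemma decidable_any_oracle: "decidable {} P \<Longrightarrow> decidable Y P"
  by (rule decidable_change_oracle[of _ "{}"]) (simp_all add: decidable_def computable_const)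

section \<open>Normal form and the third jump\<close>

text \<open>A terminating computation is witnessed by a finite set \<open>A\<close> of claims ``program \<open>e\<close> maps \<open>x\<close>
  to \<open>y\<close>'', each of which is locally justified by other members of \<open>A\<close>. No ordering of the claims is
  required: every justification refers to a smaller program, or to the same program with a smaller
  recursion counter. Claims about \<open>Query\<close> (index 4) are checked separately, so that local
  justification does not depend on the oracle. The bound \<open>s\<close> only serves to keep the intermediate
  values bounded.\<close>

definition claim :: "nat \<Rightarrow> nat \<Rightarrow> nat \<Rightarrow> nat" where
  "claim e x y = pair e (pair x y)"

definition justified :: "nat set \<Rightarrow> nat \<Rightarrow> nat \<Rightarrow> nat \<Rightarrow> nat \<Rightarrow> bool" where
  "justified A s e x y \<longleftrightarrow>
     (e = 0 \<longrightarrow> y = 0) \<and> (e = 1 \<longrightarrow> y = Suc x) \<and> (e = 2 \<longrightarrow> y = pi1 x) \<and> (e = 3 \<longrightarrow> y = pi2 x) \<and>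
     (\<forall>f\<le>e. \<forall>g\<le>e.
       (e = 5 + 4 * pair f g \<longrightarrow> (\<exists>a\<le>s. \<exists>b\<le>s. claim f x a \<in> A \<and> claim g x b \<in> A \<and> y = pair a b)) \<and>
       (e = 6 + 4 * pair f g \<longrightarrow> (\<exists>a\<le>s. claim g x a \<in> A \<and> claim f a y \<in> A)) \<and>
       (e = 7 + 4 * pair f g \<longrightarrow> (pi2 x = 0 \<longrightarrow> claim f (pi1 x) y \<in> A) \<and>
         (0 < pi2 x \<longrightarrow> (\<exists>v\<le>s. claim e (pair (pi1 x) (pi2 x - 1)) v \<in> A \<and>
            claim g (pair (pi1 x) (pair (pi2 x - 1) v)) y \<in> A)))) \<and>
     (\<forall>f\<le>e. e = 8 + 4 * f \<longrightarrow> claim f (pair x y) 0 \<in> A \<and>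
        (\<forall>m<y. \<exists>v\<le>s. claim f (pair x m) (Suc v) \<in> A))"

definition closed :: "nat set \<Rightarrow> nat \<Rightarrow> bool" where
  "closed A s \<longleftrightarrow> (\<forall>z\<in>A. justified A s (pi1 z) (pi1 (pi2 z)) (pi2 (pi2 z)))"

definition consistent :: "nat set \<Rightarrow> nat set \<Rightarrow> bool" where
  "consistent X A \<longleftrightarrow>
     (\<forall>z\<in>A. pi1 z = 4 \<longrightarrow> pi2 (pi2 z) = (if pi1 (pi2 z) \<in> X then 1 else 0))"

text \<open>Membership in \<open>A\<close> and the bounds by \<open>s\<close> occur only positively
  in \<open>justified\<close>. This allows the witnesses of several subcomputations to be
  merged.\<close>

lemma justified_mono:
  assumes "justified A s e x y" "A \<subseteq> B" "s \<le> t" shows "justified B t e x y"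
proof -
  have "z \<in> A \<longrightarrow> z \<in> B" "a \<le> s \<longrightarrow> a \<le> t" for a z using assms(2,3) by auto
  then have "justified A s e x y \<longrightarrow> justified B t e x y"
    unfolding justified_def by (intro imp_refl conj_mono all_mono ex_mono imp_mono)
  then show ?thesis using assms(1) by blast
qed

lemma run_Prec_0: "run X (Prec f g) (pair a 0) = run X f a"
  by (simp add: pair_def)

lemma run_Prec_Suc:
  "run X (Prec f g) (pair a (Suc n)) =
     Option.bind (run X (Prec f g) (pair a n)) (\<lambda>v. run X g (pair a (pair n v)))"
  by (simp add: pair_def)

lemma le_index: "f \<le> c + 4 * pair f g" "g \<le> c + 4 * pair f g"
  using le_pair[of f g] le_pair(2)[of g f] by linarith+

lemma justified_Prec:
  assumes "justified A s (7 + 4 * pair f g) x y"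
  shows "pi2 x = 0 \<Longrightarrow> claim f (pi1 x) y \<in> A"
    "0 < pi2 x \<Longrightarrow> \<exists>v\<le>s. claim (7 + 4 * pair f g) (pair (pi1 x) (pi2 x - 1)) v \<in> A \<and>
       claim g (pair (pi1 x) (pair (pi2 x - 1) v)) y \<in> A"
  using assms[unfolded justified_def, THEN conjunct2, THEN conjunct2, THEN conjunct2, THEN conjunct2,
      THEN conjunct1, THEN spec, THEN mp, OF le_index(1), THEN spec, THEN mp, OF le_index(2),
      THEN conjunct2, THEN conjunct2, THEN mp, OF refl]
  by blast+

text \<open>Soundness of claims, by induction on the program.\<close>

lemma run_eq_of_claim:
  assumes A: "closed A s" "consistent X A"
    and p: "claim (index p) x y \<in> A"
  shows "run X p x = Some y"
proof -
  have J: "justified A s e x y" if "claim e x y \<in> A" for e x y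
    using bspec[OF A(1)[unfolded closed_def] that] by (simp add: claim_def)
  show ?thesis using p
  proof (induction p arbitrary: x y)
    case Zero
    then show ?case using J[of 0] by (simp add: justified_def)
  next
    case Succ
    then show ?case using J[of 1] by (simp add: justified_def)
  next
    case Left
    then show ?case using J[of 2] by (simp add: justified_def pi1_def)
  next
    case Right
    then show ?case using J[of 3] by (simp add: justified_def pi2_def)
  next
    case Query
    then show ?case using A(2) by (force simp: consistent_def claim_def)
  next
    case (Pair f g)
    have "justified A s (5 + 4 * pair (index f) (index g)) x y"
      using J Pair.prems by (simp add: pair_def)
    then obtain a b where "claim (index f) x a \<in> A" "claim (index g) x b \<in> A" "y = pair a b"
      unfolding justified_def using le_index by blast
    then show ?case using Pair.IH by (simp add: pair_def)
  next
    case (Comp f g)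
    have "justified A s (6 + 4 * pair (index f) (index g)) x y"
      using J Comp.prems by (simp add: pair_def)
    then obtain a where "claim (index g) x a \<in> A" "claim (index f) a y \<in> A"
      unfolding justified_def using le_index by blast
    then show ?case using Comp.IH by simp
  next
    case (Prec f g)
    define e where "e = 7 + 4 * pair (index f) (index g)"
    have e: "index (Prec f g) = e" by (simp add: e_def pair_def)
    \<comment> \<open>A claim about \<open>Prec f g\<close> may rest on a claim with the same index,
      so an inner induction on the counter is needed.\<close>
    have *: "claim e (pair a n) y \<in> A \<Longrightarrow> run X (Prec f g) (pair a n) = Some y" for a n y
    proof (induction n arbitrary: y)
      case 0
      then have "justified A s e (pair a 0) y" by (rule J)
      from justified_Prec(1)[OF this[unfolded e_def]] have "claim (index f) a y \<in> A" by simp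
      then show ?case by (simp only: run_Prec_0 Prec.IH)
    next
      case (Suc n)
      from Suc.prems have "justified A s e (pair a (Suc n)) y" by (rule J)
      from justified_Prec(2)[OF this[unfolded e_def]]
      obtain v where v: "claim e (pair a n) v \<in> A" "claim (index g) (pair a (pair n v)) y \<in> A"
        by (auto simp: e_def)
      show ?case unfolding run_Prec_Suc by (simp only: Suc.IH[OF v(1)] Prec.IH(2)[OF v(2)] bind.bind_lunit)
    qed
    show ?case using *[of "pi1 x" "pi2 x"] Prec.prems unfolding e by (simp only: pi_pair)
  next
    case (Mu f)
    have "justified A s (8 + 4 * index f) x y"
      using J Mu.prems by simp
    moreover have "index f \<le> 8 + 4 * index f" by simp
    ultimately have "claim (index f) (pair x y) 0 \<in> A"
      and "\<forall>m<y. \<exists>v\<le>s. claim (index f) (pair x m) (Suc v) \<in> A"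
      unfolding justified_def by blast+
    then have y: "run X f (prod_encode (x, y)) = Some 0"
      and m: "\<forall>m<y. \<exists>v. run X f (prod_encode (x, m)) = Some (Suc v)"
      using Mu.IH unfolding pair_def by blast+
    have "(LEAST n. run X f (prod_encode (x, n)) = Some 0) = y"
    proof (rule Least_equality)
      show "run X f (prod_encode (x, y)) = Some 0" by (rule y)
      show "y \<le> n" if "run X f (prod_encode (x, n)) = Some 0" for n
        using m that by (metis not_less option.inject nat.distinct(1))
    qed
    then show ?case using y m by auto
  qed
qed

text \<open>The clause \<open>y \<le> s\<close> lets later justifications use \<open>y\<close> as an
  intermediate value within the bound.\<close>

definition derivable :: "nat set \<Rightarrow> nat \<Rightarrow> nat \<Rightarrow> nat \<Rightarrow> bool" where
  "derivable X e x y \<longleftrightarrow>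
     (\<exists>A s. finite A \<and> closed A s \<and> consistent X A \<and> claim e x y \<in> A \<and> y \<le> s)"

lemma derivable_common:
  assumes "finite Z" "\<forall>(e, x, y)\<in>Z. derivable X e x y"
  shows "\<exists>A s. finite A \<and> closed A s \<and> consistent X A \<and> (\<forall>(e, x, y)\<in>Z. claim e x y \<in> A \<and> y \<le> s)"
  using assms
proof (induction Z rule: finite_induct)
  case empty
  show ?case by (intro exI[of _ "{}"]) (simp add: closed_def consistent_def)
next
  case (insert z Z)
  obtain e x y where z: "z = (e, x, y)" by (cases z)
  obtain A s where A: "finite A" "closed A s" "consistent X A"
    "\<forall>(e, x, y)\<in>Z. claim e x y \<in> A \<and> y \<le> s"
    using insert by auto
  obtain B t where B: "finite B" "closed B t" "consistent X B" "claim e x y \<in> B" "y \<le> t"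
    using insert.prems z by (auto simp: derivable_def)
  have "closed (A \<union> B) (max s t)"
    using A(2) B(2) justified_mono[of A s _ _ _ "A \<union> B" "max s t"]
      justified_mono[of B t _ _ _ "A \<union> B" "max s t"] by (auto simp: closed_def)
  moreover have "consistent X (A \<union> B)" using A(3) B(3) by (auto simp: consistent_def)
  ultimately show ?case using A B
    by (intro exI[of _ "A \<union> B"] exI[of _ "max s t"]) (auto simp: z le_max_iff_disj)
qed

text \<open>\<open>Z\<close> collects the premises of the last computation step. Their merged
  witness is extended by the new claim, and the bound is raised to cover \<open>y\<close>.\<close>

lemma derivable_step:
  assumes Z: "finite Z" "\<forall>(e, x, y)\<in>Z. derivable X e x y"
    and step: "\<And>A s. \<forall>(e, x, y)\<in>Z. claim e x y \<in> A \<and> y \<le> s \<Longrightarrow> justified A s e x y"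
    and query: "e = 4 \<Longrightarrow> y = (if x \<in> X then 1 else 0)"
  shows "derivable X e x y"
proof -
  obtain A s where A: "finite A" "closed A s" "consistent X A"
    "\<forall>(e, x, y)\<in>Z. claim e x y \<in> A \<and> y \<le> s"
    using derivable_common[OF Z] by blast
  let ?B = "insert (claim e x y) A"
  have "justified ?B (max s y) e x y"
    using step[OF A(4)] by (rule justified_mono) auto
  then have "closed ?B (max s y)"
    using A(2) justified_mono[of A s _ _ _ ?B "max s y"] by (auto simp: closed_def claim_def)
  moreover have "consistent X ?B" using A(3) query by (auto simp: consistent_def claim_def)
  ultimately show ?thesis unfolding derivable_def using A(1)
    by (intro exI[of _ ?B] exI[of _ "max s y"]) auto
qed

lemma index_tags:
  "5 + 4 * a \<noteq> 6 + 4 * (b::nat)" "5 + 4 * a \<noteq> 7 + 4 * (b::nat)" "5 + 4 * a \<noteq> 8 + 4 * (b::nat)"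
  "6 + 4 * a \<noteq> 5 + 4 * (b::nat)" "6 + 4 * a \<noteq> 7 + 4 * (b::nat)" "6 + 4 * a \<noteq> 8 + 4 * (b::nat)"
  "7 + 4 * a \<noteq> 5 + 4 * (b::nat)" "7 + 4 * a \<noteq> 6 + 4 * (b::nat)" "7 + 4 * a \<noteq> 8 + 4 * (b::nat)"
  "8 + 4 * a \<noteq> 5 + 4 * (b::nat)" "8 + 4 * a \<noteq> 6 + 4 * (b::nat)" "8 + 4 * a \<noteq> 7 + 4 * (b::nat)"
  by presburger+

lemma index_pair:
  "index (Pair f g) = 5 + 4 * pair (index f) (index g)"
  "index (Comp f g) = 6 + 4 * pair (index f) (index g)"
  "index (Prec f g) = 7 + 4 * pair (index f) (index g)"
  by (simp_all add: pair_def)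

text \<open>Completeness, the converse of \<open>run_eq_of_claim\<close>: the subcomputations of
  each constructor supply the premises \<open>Z\<close> of \<open>derivable_step\<close>.\<close>

lemma derivable_of_run: "run X p x = Some y \<Longrightarrow> derivable X (index p) x y"
proof (induction p arbitrary: x y)
  case Zero
  then show ?case by (intro derivable_step[of "{}"]) (auto simp: justified_def)
next
  case Succ
  then show ?case by (intro derivable_step[of "{}"]) (auto simp: justified_def)
next
  case Left
  then show ?case by (intro derivable_step[of "{}"]) (auto simp: justified_def pi1_def)
next
  case Right
  then show ?case by (intro derivable_step[of "{}"]) (auto simp: justified_def pi2_def)
next
  case Query
  then show ?case by (intro derivable_step[of "{}"]) (auto simp: justified_def)
next
  case (Pair f g)
  then obtain a b where "run X f x = Some a" "run X g x = Some b" and y: "y = pair a b"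
    by (auto simp: bind_eq_Some_conv pair_def)
  then have "derivable X (index f) x a" "derivable X (index g) x b" using Pair.IH by blast+
  then show ?case unfolding index_pair
    by (intro derivable_step[of "{(index f, x, a), (index g, x, b)}"])
      (auto simp: justified_def index_tags y)
next
  case (Comp f g)
  then obtain a where "run X g x = Some a" "run X f a = Some y"
    by (auto simp: bind_eq_Some_conv)
  then have "derivable X (index g) x a" "derivable X (index f) a y" using Comp.IH by blast+
  then show ?case unfolding index_pair
    by (intro derivable_step[of "{(index g, x, a), (index f, a, y)}"])
      (auto simp: justified_def index_tags)
next
  case (Prec f g)
  have "run X (Prec f g) (pair a n) = Some y \<Longrightarrow> derivable X (index (Prec f g)) (pair a n) y" for a n y
  proof (induction n arbitrary: y)
    case 0
    then have "derivable X (index f) a y" unfolding run_Prec_0 by (rule Prec.IH)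
    then show ?case unfolding index_pair
      by (intro derivable_step[of "{(index f, a, y)}"]) (auto simp: justified_def index_tags)
  next
    case (Suc n)
    then obtain v where "run X (Prec f g) (pair a n) = Some v" "run X g (pair a (pair n v)) = Some y"
      unfolding run_Prec_Suc bind_eq_Some_conv by blast
    then have "derivable X (index (Prec f g)) (pair a n) v" "derivable X (index g) (pair a (pair n v)) y"
      using Suc.IH Prec.IH by blast+
    then show ?case unfolding index_pair
      by (intro derivable_step[of "{(7 + 4 * pair (index f) (index g), pair a n, v),
            (index g, pair a (pair n v), y)}"])
        (auto simp: justified_def index_tags)
  qed
  from this[of "pi1 x" "pi2 x"] Prec.prems show ?case by (simp only: pi_pair)
next
  case (Mu f)
  define P where "P n \<longleftrightarrow> run X f (prod_encode (x, n)) = Some 0" for n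
  obtain n where n: "P n" "\<forall>m<n. \<exists>v. run X f (prod_encode (x, m)) = Some (Suc v)"
    and y: "y = (LEAST n. P n)"
    using Mu.prems by (auto simp: P_def split: if_splits)
  have "y \<le> n" unfolding y using n(1) by (rule Least_le)
  then obtain v where v: "\<forall>m<y. run X f (pair x m) = Some (Suc (v m))"
    using n(2) unfolding pair_def by (metis less_le_trans)
  have "P y" unfolding y using n(1) by (rule LeastI)
  then have "derivable X (index f) (pair x y) 0" by (auto simp: P_def pair_def intro: Mu.IH)
  moreover have "\<forall>m<y. derivable X (index f) (pair x m) (Suc (v m))" using v Mu.IH by blast
  \<comment> \<open>The premises are the zero at \<open>y\<close> and the positive values at all
    smaller arguments.\<close>
  ultimately show ?case
    by (intro derivable_step[of "insert (index f, pair x y, 0)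
          ((\<lambda>m. (index f, pair x m, Suc (v m))) ` {..<y})"])
      (auto simp: justified_def index_tags intro: Suc_leD)
qed

text \<open>Kleene's normal form. With claim sets coded as numbers, halting is an unbounded search
  over a predicate decidable in \<open>X\<close>.\<close>

lemma run_ne_None_iff:
  "run X p x \<noteq> None \<longleftrightarrow> (\<exists>u s. closed (set_decode u) s \<and> consistent X (set_decode u) \<and>
     (\<exists>y\<le>s. claim (index p) x y \<in> set_decode u))"
proof
  assume "run X p x \<noteq> None"
  then obtain y where "run X p x = Some y" by blast
  then obtain A s where "finite A" "closed A s" "consistent X A" "claim (index p) x y \<in> A" "y \<le> s"
    using derivable_of_run unfolding derivable_def by meson
  then show "\<exists>u s. closed (set_decode u) s \<and> consistent X (set_decode u) \<and>
     (\<exists>y\<le>s. claim (index p) x y \<in> set_decode u)"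
    by (metis set_encode_inverse)
qed (use run_eq_of_claim in blast)

lemma le_of_mem_set_decode: "z \<in> set_decode u \<Longrightarrow> z \<le> u"
proof (rule ccontr)
  assume z: "z \<in> set_decode u" and "\<not> z \<le> u"
  then have "u < 2 ^ z" using less_exp[of z] by linarith
  then show False using z by (simp add: set_decode_def)
qed

lemma ball_set_decode: "(\<forall>z\<in>set_decode u. P z) \<longleftrightarrow> (\<forall>z\<le>u. z \<in> set_decode u \<longrightarrow> P z)"
  using le_of_mem_set_decode by blast

lemma decidable_closed:
  assumes "computable X u" "computable X s"
  shows "decidable X (\<lambda>x. closed (set_decode (u x)) (s x))"
  unfolding closed_def justified_def claim_def ball_set_decode
  by (intro computable_intros computable_diff decidable_set_decode
      computable_comp[OF assms(1)] computable_comp[OF assms(2)])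

lemma decidable_consistent:
  assumes "computable X u"
  shows "decidable X (\<lambda>x. consistent X (set_decode (u x)))"
  unfolding consistent_def ball_set_decode
  by (intro computable_intros decidable_set_decode decidable_oracle computable_comp[OF assms(1)])

text \<open>The normal form of a program run on its own index; \<open>t\<close> packs the coded
  claim set and its bound.\<close>

lemma jump_eq_ex:
  obtains R where "decidable X (\<lambda>z. R (pi1 z) (pi2 z))" "\<And>x. x \<in> jump X \<longleftrightarrow> (\<exists>t. R x t)"
proof
  let ?R = "\<lambda>x t. closed (set_decode (pi1 t)) (pi2 t) \<and> consistent X (set_decode (pi1 t)) \<and>
    (\<exists>y\<le>pi2 t. claim x x y \<in> set_decode (pi1 t))"
  show "decidable X (\<lambda>z. ?R (pi1 z) (pi2 z))"
    unfolding claim_def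
    by (intro decidable_closed decidable_consistent decidable_set_decode computable_intros)
  fix x
  obtain p where p: "index p = x" using surj_index by blast
  show "x \<in> jump X \<longleftrightarrow> (\<exists>t. ?R x t)"
    using index_in_jump[of p X] run_ne_None_iff[of X p x] unfolding p by (metis pi_pair(1,2))
qed

text \<open>In the normal form for a computation with oracle \<open>jump X\<close>, the finitely many positive answers
  have bounded witnesses, and the negative answers are universal.\<close>

lemma ce_in_jump:
  assumes "decidable (jump X) (\<lambda>z. Q (pi1 z) (pi2 z))"
  obtains P where "decidable X (\<lambda>z. P (pi1 z) (pi1 (pi2 z)) (pi2 (pi2 z)))"
    "\<And>k. (\<exists>t. Q k t) \<longleftrightarrow> (\<exists>a. \<forall>b. P k a b)"
proof -
  obtain p where p: "\<And>k. run (jump X) p k \<noteq> None \<longleftrightarrow> (\<exists>t. Q k t)"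
    using run_Mu_ne_None[OF assms] by blast
  obtain R where R: "decidable X (\<lambda>z. R (pi1 z) (pi2 z))" "\<And>x. x \<in> jump X \<longleftrightarrow> (\<exists>t. R x t)"
    by (rule jump_eq_ex[of X]) (rule that)
  define C where "C u m b \<longleftrightarrow> (\<forall>z\<in>set_decode u. pi1 z = 4 \<longrightarrow>
      pi2 (pi2 z) = 1 \<and> (\<exists>t<m. R (pi1 (pi2 z)) t) \<or> pi2 (pi2 z) = 0 \<and> \<not> R (pi1 (pi2 z)) b)" for u m b
  have C: "consistent (jump X) (set_decode u) \<longleftrightarrow> (\<exists>m. \<forall>b. C u m b)" for u
  proof
    assume u: "consistent (jump X) (set_decode u)"
    obtain t where t: "\<And>x. x \<in> jump X \<Longrightarrow> R x (t x)" using R(2) by metis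
    obtain m where m: "\<forall>z\<in>set_decode u. t (pi1 (pi2 z)) < m"
      using finite_nat_set_iff_bounded[of "(\<lambda>z. t (pi1 (pi2 z))) ` set_decode u"] by auto
    have "C u m b" for b
      unfolding C_def
    proof (intro ballI impI)
      fix z assume z: "z \<in> set_decode u" "pi1 z = 4"
      show "pi2 (pi2 z) = 1 \<and> (\<exists>t<m. R (pi1 (pi2 z)) t) \<or> pi2 (pi2 z) = 0 \<and> \<not> R (pi1 (pi2 z)) b"
      proof (cases "pi1 (pi2 z) \<in> jump X")
        case True
        then show ?thesis using u z t m by (auto simp: consistent_def)
      next
        case False
        then show ?thesis using u z R(2) by (auto simp: consistent_def)
      qed
    qed
    then show "\<exists>m. \<forall>b. C u m b" by blast
  next
    assume "\<exists>m. \<forall>b. C u m b"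
    then obtain m where m: "\<And>b. C u m b" by blast
    show "consistent (jump X) (set_decode u)"
      unfolding consistent_def
    proof (intro ballI impI)
      fix z assume "z \<in> set_decode u" "pi1 z = 4"
      then have *: "pi2 (pi2 z) = 1 \<and> (\<exists>t<m. R (pi1 (pi2 z)) t) \<or>
          pi2 (pi2 z) = 0 \<and> \<not> R (pi1 (pi2 z)) b" for b
        using m[of b] unfolding C_def by blast
      show "pi2 (pi2 z) = (if pi1 (pi2 z) \<in> jump X then 1 else 0)"
      proof (cases "\<exists>t. R (pi1 (pi2 z)) t")
        case True
        then obtain b where "R (pi1 (pi2 z)) b" by blast
        \<comment> \<open>The witness \<open>b\<close> refutes the negative alternative at this very
          \<open>b\<close>, which leaves the answer 1.\<close>
        then show ?thesis using *[of b] by (auto simp: R(2))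
      next
        case False
        then show ?thesis using * by (auto simp: R(2))
      qed
    qed
  qed
  \<comment> \<open>The number \<open>a\<close> packs the claim set, its bound, and the bound
    \<open>m\<close> on the witnesses of positive answers.\<close>
  define P where "P k a b \<longleftrightarrow> closed (set_decode (pi1 (pi1 a))) (pi2 (pi1 a)) \<and>
     (\<exists>y\<le>pi2 (pi1 a). claim (index p) k y \<in> set_decode (pi1 (pi1 a))) \<and>
     C (pi1 (pi1 a)) (pi2 a) b" for k a b
  have R': "decidable X (\<lambda>x. R (f x) (g x))" if "computable X f" "computable X g" for f g
    using decidable_comp[OF R(1) computable_pair[OF that]] by simp
  show ?thesis
  proof
    show "decidable X (\<lambda>z. P (pi1 z) (pi1 (pi2 z)) (pi2 (pi2 z)))"
      unfolding P_def C_def claim_def ball_set_decode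
      by (intro computable_intros decidable_closed decidable_set_decode R')
    fix k
    have "(\<exists>t. Q k t) \<longleftrightarrow> (\<exists>u s. closed (set_decode u) s \<and> (\<exists>m. \<forall>b. C u m b) \<and>
        (\<exists>y\<le>s. claim (index p) k y \<in> set_decode u))"
      unfolding C[symmetric] p[symmetric] by (rule run_ne_None_iff)
    also have "\<dots> \<longleftrightarrow> (\<exists>u s m. \<forall>b. P k (pair (pair u s) m) b)" by (auto simp: P_def)
    also have "\<dots> \<longleftrightarrow> (\<exists>a. \<forall>b. P k a b)" by (metis pi_pair(3))
    finally show "(\<exists>t. Q k t) \<longleftrightarrow> (\<exists>a. \<forall>b. P k a b)" .
  qed
qed

text \<open>Each use of \<open>ce_in_jump\<close> removes one jump from the oracle and adds a
  quantifier alternation. The second use is for the negation of \<open>P\<close>, with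
  \<open>k\<close> and \<open>a\<close> packed into one argument; negating back gives the inner
  quantifiers.\<close>

lemma third_jump_iff:
  obtains M where "decidable {} (\<lambda>z. M (pi1 z) (pi1 (pi2 z)) (pi1 (pi2 (pi2 z))) (pi2 (pi2 (pi2 z))))"
    "\<And>k. k \<in> jump (jump (jump {})) \<longleftrightarrow> (\<exists>a. \<forall>b. \<exists>c. M k a b c)"
proof -
  obtain R where R: "decidable (jump (jump {})) (\<lambda>z. R (pi1 z) (pi2 z))"
    "\<And>x. x \<in> jump (jump (jump {})) \<longleftrightarrow> (\<exists>t. R x t)"
    by (rule jump_eq_ex[of "jump (jump {})"]) (rule that)
  obtain P where P: "decidable (jump {}) (\<lambda>z. P (pi1 z) (pi1 (pi2 z)) (pi2 (pi2 z)))"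
    "\<And>k. (\<exists>t. R k t) \<longleftrightarrow> (\<exists>a. \<forall>b. P k a b)"
    by (rule ce_in_jump[OF R(1)]) (rule that)
  have P': "decidable (jump {}) (\<lambda>z. \<not> P (pi1 (pi1 z)) (pi2 (pi1 z)) (pi2 z))"
    using decidable_not[OF decidable_comp[OF P(1), of "\<lambda>z. pair (pi1 (pi1 z)) (pair (pi2 (pi1 z)) (pi2 z))"]]
    by (simp add: computable_base)
  obtain N where N: "decidable {} (\<lambda>z. N (pi1 z) (pi1 (pi2 z)) (pi2 (pi2 z)))"
    "\<And>k. (\<exists>t. \<not> P (pi1 k) (pi2 k) t) \<longleftrightarrow> (\<exists>a. \<forall>b. N k a b)"
    by (rule ce_in_jump[OF P', of thesis]) (rule that)
  show ?thesis
  proof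
    show "decidable {} (\<lambda>z. \<not> N (pair (pi1 z) (pi1 (pi2 z))) (pi1 (pi2 (pi2 z))) (pi2 (pi2 (pi2 z))))"
      using decidable_not[OF decidable_comp[OF N(1), of "\<lambda>z. pair (pair (pi1 z) (pi1 (pi2 z))) (pi2 (pi2 z))"]]
      by (simp add: computable_base)
    fix k
    have "(\<forall>b. P k a b) \<longleftrightarrow> (\<forall>c. \<exists>d. \<not> N (pair k a) c d)" for a
      using N(2)[of "pair k a"] by auto
    then show "k \<in> jump (jump (jump {})) \<longleftrightarrow> (\<exists>a. \<forall>c. \<exists>d. \<not> N (pair k a) c d)"
      by (simp add: R(2) P(2))
  qed
qed

section \<open>Guessing the least witness\<close>

text \<open>For some \<open>b\<close>, stage \<open>j\<close> is the first one \<open>\<ge> b\<close> at which all \<open>b' \<le> b\<close> have a witness.\<close>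

definition expansionary :: "(nat \<Rightarrow> nat \<Rightarrow> bool) \<Rightarrow> nat \<Rightarrow> bool" where
  "expansionary M j \<longleftrightarrow>
     (\<exists>b\<le>j. (\<forall>b'\<le>b. \<exists>c\<le>j. M b' c) \<and> (b = j \<or> \<not> (\<forall>b'\<le>b. \<exists>c<j. M b' c)))"

text \<open>If witnesses always exist, the first stage from \<open>b\<close> on that has witnesses
  for all \<open>b' \<le> b\<close> is expansionary. If \<open>b0\<close> has none, only
  \<open>b < b0\<close> can make \<open>j\<close> expansionary, and then \<open>j\<close> is
  \<open>b\<close> itself or the least witness of some \<open>b' \<le> b\<close>; this leaves
  finitely many \<open>j\<close>.\<close>

lemma infinite_expansionary: "infinite {j. expansionary M j} \<longleftrightarrow> (\<forall>b. \<exists>c. M b c)"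
proof
  assume M: "\<forall>b. \<exists>c. M b c"
  have "\<exists>j\<ge>b. expansionary M j" for b
  proof -
    obtain w where w: "\<And>b. M b (w b)" using M by metis
    obtain n where n: "\<forall>b'\<le>b. w b' \<le> n"
      using finite_nat_set_iff_bounded_le[of "w ` {..b}"] by auto
    define Q where "Q j \<longleftrightarrow> b \<le> j \<and> (\<forall>b'\<le>b. \<exists>c\<le>j. M b' c)" for j
    have "Q (max b n)" unfolding Q_def using w n by (metis max.cobounded1 max.coboundedI2)
    then obtain j where j: "Q j" "\<forall>i<j. \<not> Q i" using exists_least_iff[of Q] by blast
    have "b = j \<or> \<not> (\<forall>b'\<le>b. \<exists>c<j. M b' c)"
    proof (rule ccontr)
      assume not: "\<not> (b = j \<or> \<not> (\<forall>b'\<le>b. \<exists>c<j. M b' c))"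
      then have "b < j" using j(1) by (auto simp: Q_def)
      then have "Q (j - 1)" using not unfolding Q_def by (metis Suc_diff_1 gr_zeroI less_Suc_eq_le not_less_zero)
      then show False using j(2) \<open>b < j\<close> by auto
    qed
    then show ?thesis using j(1) unfolding Q_def expansionary_def by blast
  qed
  then show "infinite {j. expansionary M j}" unfolding infinite_nat_iff_unbounded_le by blast
next
  assume inf: "infinite {j. expansionary M j}"
  show "\<forall>b. \<exists>c. M b c"
  proof (rule ccontr)
    assume "\<not> (\<forall>b. \<exists>c. M b c)"
    then obtain b0 where b0: "\<And>c. \<not> M b0 c" by blast
    have "j \<in> {..<b0} \<union> (\<lambda>b. LEAST c. M b c) ` {..<b0}" if j: "expansionary M j" for j
    proof -
      obtain b where b: "b \<le> j" "\<forall>b'\<le>b. \<exists>c\<le>j. M b' c" "b = j \<or> \<not> (\<forall>b'\<le>b. \<exists>c<j. M b' c)"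
        using j unfolding expansionary_def by blast
      have "b < b0"
      proof (rule ccontr)
        assume "\<not> b < b0"
        then show False using spec[OF b(2), of b0] b0 by simp
      qed
      show ?thesis
      proof (cases "b = j")
        case True
        then show ?thesis using \<open>b < b0\<close> by auto
      next
        case False
        then obtain b' where b': "b' \<le> b" "\<not> (\<exists>c<j. M b' c)" using b(3) by blast
        moreover obtain c where "c \<le> j" "M b' c" using b(2) b'(1) by blast
        ultimately have "(LEAST c. M b' c) = j"
          by (metis Least_equality le_neq_implies_less not_less)
        then show ?thesis using b'(1) \<open>b < b0\<close> by force
      qed
    qed
    then have "{j. expansionary M j} \<subseteq> {..<b0} \<union> (\<lambda>b. LEAST c. M b c) ` {..<b0}" by blast
    then show False using inf by (meson finite_UnI finite_imageI finite_lessThan finite_subset)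
  qed
qed

text \<open>The \<open>n\<close>-th approximation believes \<open>a\<close> at stage \<open>j\<close> only if no smaller candidate has acted in
  \<open>[n, j)\<close>. Hence candidates above one that acts infinitely often are believed only finitely often,
  which makes the approximations stabilise modulo finite sets.\<close>

definition guess :: "(nat \<Rightarrow> nat \<Rightarrow> bool) \<Rightarrow> nat \<Rightarrow> nat \<Rightarrow> bool" where
  "guess E n j \<longleftrightarrow> (\<exists>a<n. E a j \<and> (\<forall>i<j. n \<le> i \<longrightarrow> (\<forall>a'<a. \<not> E a' i)))"

text \<open>The second clause also covers small \<open>n\<close>, so that no approximation, however
  early, wrongly looks infinite.\<close>

definition settles :: "(nat \<Rightarrow> nat \<Rightarrow> bool) \<Rightarrow> nat set \<Rightarrow> bool" where
  "settles H Z \<longleftrightarrow> (\<exists>m. \<forall>n\<ge>m. finite {j. H n j \<noteq> (j \<in> Z)}) \<and>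
     (finite Z \<longrightarrow> (\<forall>n. finite {j. H n j}))"

text \<open>\<open>Z\<close> is the set of stages at which the least infinitely active candidate
  \<open>a0\<close> acts. Smaller candidates are silent from \<open>m0\<close> on, so they cannot
  veto \<open>a0\<close> once \<open>n \<ge> m0\<close>; larger ones are vetoed after the first
  action of \<open>a0\<close> at or beyond \<open>n\<close>. If there is no \<open>a0\<close>, the
  bound \<open>a < n\<close> leaves a finite union of finite sets.\<close>

lemma settles_guess:
  "\<exists>Z. settles (guess E) Z \<and> (infinite Z \<longleftrightarrow> (\<exists>a. infinite {j. E a j}))"
proof (cases "\<exists>a. infinite {j. E a j}")
  case False
  have "finite {j. guess E n j}" for n
  proof (rule finite_subset)
    show "{j. guess E n j} \<subseteq> (\<Union>a<n. {j. E a j})" by (auto simp: guess_def)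
    show "finite (\<Union>a<n. {j. E a j})" using False by auto
  qed
  then show ?thesis using False by (intro exI[of _ "{}"]) (simp add: settles_def)
next
  case True
  then obtain a0 where a0: "infinite {j. E a0 j}" "\<forall>a<a0. finite {j. E a j}"
    using exists_least_iff[of "\<lambda>a. infinite {j. E a j}"] by blast
  have "finite (\<Union>a<a0. {j. E a j})" using a0(2) by auto
  then obtain m0 where "\<forall>j\<in>(\<Union>a<a0. {j. E a j}). j < m0" using finite_nat_set_iff_bounded by blast
  then have m0: "\<And>a j. a < a0 \<Longrightarrow> E a j \<Longrightarrow> j < m0" by blast
  define m where "m = max m0 (Suc a0)"
  have "finite {j. guess E n j \<noteq> (j \<in> {j. E a0 j})}" if n: "n \<ge> m" for n
  proof -
    obtain i where i: "i \<ge> n" "E a0 i"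
      using a0(1) unfolding infinite_nat_iff_unbounded_le by blast
    have "j \<le> max m0 i" if neq: "guess E n j \<noteq> E a0 j" for j
    proof (cases "E a0 j")
      case True
      then have "guess E n j"
        unfolding guess_def using n m0 by (intro exI[of _ a0]) (fastforce simp: m_def)
      then show ?thesis using neq True by simp
    next
      case False
      then obtain a where a: "a < n" "E a j" "\<forall>i<j. n \<le> i \<longrightarrow> (\<forall>a'<a. \<not> E a' i)"
        using neq unfolding guess_def by blast
      have "a \<noteq> a0" using a(2) False by blast
      then consider "a < a0" | "a0 < a" by linarith
      then show ?thesis
      proof cases
        case 1
        then show ?thesis using m0 a(2) by fastforce
      next
        case 2
        then have "\<not> i < j" using a(3) i by blast
        then show ?thesis by simp
      qed
    qed
    then have "{j. guess E n j \<noteq> (j \<in> {j. E a0 j})} \<subseteq> {..max m0 i}" by auto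
    then show ?thesis by (rule finite_subset) simp
  qed
  then have "settles (guess E) {j. E a0 j}" using a0(1) unfolding settles_def by blast
  then show ?thesis using a0(1) True by blast
qed

text \<open>If \<open>Q\<close> is finite, every \<open>n\<close> beyond its last element gives all
  of \<open>UNIV\<close>; otherwise an element of \<open>Q\<close> at or beyond \<open>n\<close>
  stops the set of \<open>j\<close>, and \<open>Z\<close> is empty.\<close>

lemma settles_quiet:
  "\<exists>Z. settles (\<lambda>n j. \<forall>b<j. n \<le> b \<longrightarrow> \<not> Q b) Z \<and> (infinite Z \<longleftrightarrow> finite {b. Q b})"
proof (cases "finite {b. Q b}")
  case True
  then obtain m where "\<forall>b\<in>{b. Q b}. b < m" using finite_nat_set_iff_bounded by blast
  then have m: "\<And>b. Q b \<Longrightarrow> b < m" by blast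
  have "{j. (\<forall>b<j. n \<le> b \<longrightarrow> \<not> Q b) \<noteq> (j \<in> UNIV)} = {}" if "n \<ge> m" for n
    using m that by fastforce
  then have "settles (\<lambda>n j. \<forall>b<j. n \<le> b \<longrightarrow> \<not> Q b) UNIV"
    unfolding settles_def by (intro conjI exI[of _ m]) simp_all
  then show ?thesis using True by (intro exI[of _ UNIV]) simp
next
  case False
  have "finite {j. \<forall>b<j. n \<le> b \<longrightarrow> \<not> Q b}" for n
  proof -
    obtain b where "b \<ge> n" "Q b" using False unfolding infinite_nat_iff_unbounded_le by blast
    then have "{j. \<forall>b<j. n \<le> b \<longrightarrow> \<not> Q b} \<subseteq> {..b}" by (auto simp: not_less[symmetric])
    then show ?thesis by (rule finite_subset) simp
  qed
  then have "settles (\<lambda>n j. \<forall>b<j. n \<le> b \<longrightarrow> \<not> Q b) {}"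
    unfolding settles_def empty_iff by (simp only: simp_thms)
  then show ?thesis using False by blast
qed

text \<open>The condition is inherited by smaller \<open>j\<close>, so holding infinitely often
  means holding always.\<close>

lemma infinite_quiet_iff:
  fixes Q :: "nat \<Rightarrow> bool"
  shows "infinite {j. \<forall>b<j. n \<le> b \<longrightarrow> \<not> Q b} \<longleftrightarrow> (\<forall>b\<ge>n. \<not> Q b)"
proof
  assume inf: "infinite {j. \<forall>b<j. n \<le> b \<longrightarrow> \<not> Q b}"
  show "\<forall>b\<ge>n. \<not> Q b"
  proof (intro allI impI)
    fix b assume "n \<le> b"
    moreover obtain j where "j > b" "\<forall>b<j. n \<le> b \<longrightarrow> \<not> Q b"
      using inf unfolding infinite_nat_iff_unbounded by blast
    ultimately show "\<not> Q b" by blast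
  qed
qed simp

section \<open>Coding into columns of positive density\<close>

text \<open>Column \<open>i\<close> consists of the numbers whose exact power of two is
  \<open>2 ^ i\<close>. The bound \<open>t \<le> x\<close> loses nothing and permits a bounded
  search.\<close>

definition block :: "nat \<Rightarrow> nat \<Rightarrow> nat set" where
  "block i j = {x. 2 ^ j \<le> x \<and> x < 2 * 2 ^ j \<and> (\<exists>t\<le>x. x = 2 ^ i * (2 * t + 1))}"

definition columns :: "(nat \<Rightarrow> nat \<Rightarrow> nat \<Rightarrow> bool) \<Rightarrow> nat \<Rightarrow> nat set" where
  "columns H n = {x. \<exists>i\<le>x. \<exists>j\<le>x. x \<in> block i j \<and> H i n j}"

lemma block_unique: "x \<in> block i j \<Longrightarrow> x \<in> block i' j' \<Longrightarrow> i = i' \<and> j = j'"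
proof -
  assume a: "x \<in> block i j" and b: "x \<in> block i' j'"
  obtain t t' where t: "x = 2 ^ i * (2 * t + 1)" "x = 2 ^ i' * (2 * t' + 1)"
    using a b unfolding block_def by blast
  have *: False if pq: "p < q" "2 ^ p * (2 * s + 1) = 2 ^ q * (2 * s' + 1)" for p q s s' :: nat
  proof -
    obtain d where "q = p + Suc d" using less_imp_Suc_add[OF pq(1)] by auto
    then have "2 ^ p * (2 * s + 1) = 2 ^ p * (2 * (2 ^ d * (2 * s' + 1)))"
      using pq(2) by (simp only: power_add power_Suc ac_simps)
    then have "2 * s + 1 = 2 * (2 ^ d * (2 * s' + 1))" by (subst (asm) mult_left_cancel) simp
    then show False by presburger
  qed
  have "i = i'" using *[of i i'] *[of i' i] t by (metis linorder_neqE_nat)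
  moreover have "(2::nat) ^ j < 2 ^ Suc j'" "(2::nat) ^ j' < 2 ^ Suc j"
    using a b by (auto simp: block_def)
  then have "j < Suc j'" "j' < Suc j" by (simp_all only: power_strict_increasing_iff one_less_numeral_iff semiring_norm)
  ultimately show ?thesis by simp
qed

lemma block_le: "x \<in> block i j \<Longrightarrow> i \<le> x \<and> j \<le> x"
proof -
  assume x: "x \<in> block i j"
  have "j < 2 ^ j" "i < 2 ^ i" by (rule less_exp)+
  moreover have "2 ^ i \<le> x" "2 ^ j \<le> x" using x by (auto simp: block_def)
  ultimately show ?thesis by linarith
qed

lemma mem_columns: "x \<in> block i j \<Longrightarrow> x \<in> columns H n \<longleftrightarrow> H i n j"
  unfolding columns_def using block_unique block_le by blast

text \<open>The odd multipliers \<open>2 * t + 1\<close> with \<open>t\<close> in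
  \<open>{?d..<2 * ?d}\<close> already supply \<open>?d\<close> elements, and
  \<open>2 ^ j = 2 * 2 ^ i * ?d\<close>.\<close>

lemma card_block:
  assumes "i < j" shows "2 ^ j \<le> 2 * 2 ^ i * card (block i j)"
proof -
  let ?d = "2 ^ (j - i - 1) :: nat"
  let ?f = "\<lambda>t. 2 ^ i * (2 * t + 1) :: nat"
  have d: "2 ^ j = 2 * 2 ^ i * ?d"
    using assms by (simp flip: power_Suc power_add)
  have "?f ` {?d..<2 * ?d} \<subseteq> block i j"
  proof (rule image_subsetI)
    fix t assume t: "t \<in> {?d..<2 * ?d}"
    have "2 ^ i * (2 * ?d) \<le> 2 ^ i * (2 * t + 1)" using t by (intro mult_left_mono) auto
    then have "2 ^ j \<le> ?f t" unfolding d by (simp add: ac_simps)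
    moreover have "2 * t + 1 < 2 * (2 * ?d)" using t by simp
    then have "?f t < 2 ^ i * (2 * (2 * ?d))" by (subst mult_less_cancel1) simp
    then have "?f t < 2 * 2 ^ j" unfolding d by (simp add: ac_simps)
    moreover have "1 * (2 * t + 1) \<le> 2 ^ i * (2 * t + 1)" by (intro mult_right_mono) auto
    then have "t \<le> ?f t" by (rule order_trans[rotated]) simp
    ultimately show "?f t \<in> block i j" unfolding block_def by blast
  qed
  moreover have "finite (block i j)" by (rule finite_subset[of _ "{..<2 * 2 ^ j}"]) (auto simp: block_def)
  moreover have "inj_on ?f {?d..<2 * ?d}" by (rule inj_onI) simp
  ultimately have "card {?d..<2 * ?d} \<le> card (block i j)" by (metis card_image card_mono)
  then show ?thesis unfolding d by simp
qed

text \<open>Counting in this form is computable, and \<open>diff_count A B x * 2 ^ k \<le> x\<close>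
  expresses a density bound without real numbers.\<close>

definition diff_count :: "nat set \<Rightarrow> nat set \<Rightarrow> nat \<Rightarrow> nat" where
  "diff_count A B x = card {y. y < x \<and> (y \<in> A \<and> y \<notin> B \<or> y \<notin> A \<and> y \<in> B)}"

lemma rho_sym_diff: "rho x (sym_diff A B) = diff_count A B x / x"
  unfolding rho_def diff_count_def by (rule arg_cong[of _ _ "\<lambda>S. real (card S) / real x"]) auto

lemma diff_count_triangle: "diff_count A C x \<le> diff_count A B x + diff_count C B x"
  unfolding diff_count_def
  by (rule order_trans[OF card_mono card_Un_le]) auto

text \<open>Giving away a factor of two makes the bound on the \<open>limsup\<close> strict, hence
  eventually true of the terms.\<close>

lemma eventually_diff_count:
  assumes "delta A B \<le> ereal (1 / 2 ^ Suc k)"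
  obtains N where "\<And>x. x \<ge> N \<Longrightarrow> diff_count A B x * 2 ^ k \<le> x"
proof -
  have "ereal (1 / 2 ^ Suc k) < ereal (1 / 2 ^ k)" by (simp add: field_simps)
  then have "limsup (\<lambda>n. ereal (rho n (sym_diff A B))) < ereal (1 / 2 ^ k)"
    using assms unfolding delta_def by (rule le_less_trans[rotated])
  then have "eventually (\<lambda>n. ereal (rho n (sym_diff A B)) < ereal (1 / 2 ^ k)) sequentially"
    by (rule Limsup_lessD)
  then obtain N where N: "\<And>x. x \<ge> N \<Longrightarrow> diff_count A B x / x < 1 / 2 ^ k"
    unfolding eventually_sequentially rho_sym_diff by auto
  have "diff_count A B x * 2 ^ k \<le> x" if "x \<ge> max N 1" for x
  proof -
    have "real (diff_count A B x * 2 ^ k) < real x"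
      using N[of x] that by (simp add: field_simps)
    then show ?thesis by linarith
  qed
  then show ?thesis by (rule that)
qed

lemma delta_le:
  assumes "\<And>x. x \<ge> N \<Longrightarrow> diff_count A B x * 2 ^ k \<le> x"
  shows "delta A B \<le> ereal (1 / 2 ^ k)"
  unfolding delta_def
proof (rule Limsup_bounded)
  have "ereal (rho x (sym_diff A B)) \<le> ereal (1 / 2 ^ k)" if "x \<ge> max N 1" for x
  proof -
    have "real (diff_count A B x * 2 ^ k) \<le> real x"
      using assms[of x] that by (intro of_nat_mono) simp
    then show ?thesis using that by (simp add: rho_sym_diff field_simps)
  qed
  then show "eventually (\<lambda>x. ereal (rho x (sym_diff A B)) \<le> ereal (1 / 2 ^ k)) sequentially"
    unfolding eventually_sequentially by blast
qed

text \<open>From \<open>m0\<close> on, the columns \<open>i \<le> k\<close> of two members differ in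
  finitely many blocks only. All other differences are multiples of \<open>2 ^ Suc k\<close>, hence
  sparse.\<close>

lemma delta_Cauchy_columns:
  assumes "\<And>i. \<exists>Z. settles (H i) Z"
  shows "delta_Cauchy (columns H)"
  unfolding delta_Cauchy_def
proof
  fix k
  obtain Z where "\<And>i. settles (H i) (Z i)" using assms by metis
  then obtain m where m: "\<And>i n. n \<ge> m i \<Longrightarrow> finite {j. H i n j \<noteq> (j \<in> Z i)}"
    unfolding settles_def by metis
  obtain m0 where m0: "\<forall>i\<in>m ` {..k}. i \<le> m0" using finite_nat_set_iff_bounded_le by blast
  have "delta (columns H m0) (columns H n) \<le> ereal (1 / 2 ^ k)" if n: "n > m0" for n
  proof -
    define F where "F = (\<Union>i\<le>k. {j. H i m0 j \<noteq> (j \<in> Z i)} \<union> {j. H i n j \<noteq> (j \<in> Z i)})"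
    have "m i \<le> m0" if "i \<le> k" for i using m0 that by auto
    then have "finite F" unfolding F_def using n by (intro finite_UN_I finite_UnI m) force+
    then obtain J where J: "\<forall>j\<in>F. j < J" using finite_nat_set_iff_bounded by blast
    have sub: "x < 2 ^ J \<or> 2 ^ Suc k dvd x" if x: "x \<in> columns H m0 \<longleftrightarrow> x \<notin> columns H n" for x
    proof -
      obtain i j where ij: "x \<in> block i j" using x unfolding columns_def by blast
      then have ne: "H i m0 j \<noteq> H i n j" using x mem_columns by blast
      show ?thesis
      proof (cases "i \<le> k")
        case True
        then have "j \<in> F" using ne by (auto simp: F_def)
        then have "Suc j \<le> J" using J by auto
        then have "2 ^ Suc j \<le> (2 ^ J :: nat)" by (rule power_increasing) simp
        then show ?thesis using ij by (auto simp: block_def)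
      next
        case False
        then have "2 ^ Suc k dvd (2 ^ i :: nat)" by (intro le_imp_power_dvd) simp
        moreover have "2 ^ i dvd x" using ij by (auto simp: block_def)
        ultimately show ?thesis using dvd_trans by blast
      qed
    qed
    have bound: "diff_count (columns H m0) (columns H n) x \<le> 2 ^ J + (x div 2 ^ Suc k + 1)" for x
    proof -
      have "y \<in> {..<2 ^ J} \<union> (\<lambda>t. 2 ^ Suc k * t) ` {..x div 2 ^ Suc k}"
        if y: "y < x" "y \<in> columns H m0 \<longleftrightarrow> y \<notin> columns H n" for y
      proof (cases "y < 2 ^ J")
        case False
        then obtain t where t: "y = 2 ^ Suc k * t" using sub y(2) by (meson dvdE)
        then have "t = y div 2 ^ Suc k" by simp
        then have "t \<le> x div 2 ^ Suc k" using y(1) by (simp only: div_le_mono less_imp_le)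
        then show ?thesis using t by blast
      qed simp
      then have "{y. y < x \<and> (y \<in> columns H m0 \<and> y \<notin> columns H n \<or> y \<notin> columns H m0 \<and> y \<in> columns H n)}
          \<subseteq> {..<2 ^ J} \<union> (\<lambda>t. 2 ^ Suc k * t) ` {..x div 2 ^ Suc k}" by blast
      then have "diff_count (columns H m0) (columns H n) x
          \<le> card ({..<2 ^ J} \<union> (\<lambda>t. 2 ^ Suc k * t) ` {..x div 2 ^ Suc k})"
        unfolding diff_count_def by (intro card_mono) auto
      also have "\<dots> \<le> card {..<(2::nat) ^ J} + card ((\<lambda>t. 2 ^ Suc k * t) ` {..x div 2 ^ Suc k})"
        by (rule card_Un_le)
      also have "\<dots> \<le> 2 ^ J + card {..x div 2 ^ Suc k}"
        by (intro add_mono card_image_le) auto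
      finally show ?thesis by simp
    qed
    show ?thesis
    proof (rule delta_le)
      \<comment> \<open>Beyond this threshold the constant part of \<open>bound\<close>, scaled by
        \<open>2 ^ Suc k\<close>, is at most \<open>x\<close>; so is the scaled quotient.\<close>
      fix x :: nat assume x: "x \<ge> 2 ^ Suc k * (2 ^ J + 1)"
      have "2 * (diff_count (columns H m0) (columns H n) x * 2 ^ k)
          = 2 ^ Suc k * diff_count (columns H m0) (columns H n) x" by simp
      also have "\<dots> \<le> 2 ^ Suc k * (2 ^ J + (x div 2 ^ Suc k + 1))"
        using bound by (rule mult_le_mono2)
      also have "\<dots> = 2 ^ Suc k * (2 ^ J + 1) + 2 ^ Suc k * (x div 2 ^ Suc k)"
        by (simp add: algebra_simps)
      also have "\<dots> \<le> x + x" using x by (intro add_mono times_div_less_eq_dividend)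
      finally show "diff_count (columns H m0) (columns H n) x * 2 ^ k \<le> x" by linarith
    qed
  qed
  then show "\<exists>m. \<forall>n>m. delta (columns H m) (columns H n) \<le> ereal (1 / 2 ^ k)" by blast
qed

text \<open>If column \<open>i\<close> of the limit is infinite but that of \<open>columns H n\<close> is finite, then \<open>columns H n\<close>
  differs from the limit on infinitely many blocks \<open>block i j\<close>, each of relative density
  \<open>2 ^ - (i + 2)\<close> in \<open>[0, 2 ^ (j + 1))\<close>.\<close>

lemma infinite_iff_of_close:
  assumes Z: "settles (H i) Z" and L: "delta_limit (columns H) L"
    and close: "\<And>x. x \<ge> N \<Longrightarrow> diff_count (columns H n) L x * 2 ^ (i + 4) \<le> x"
  shows "infinite {j. H i n j} \<longleftrightarrow> infinite Z"
proof
  assume "infinite Z"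
  show "infinite {j. H i n j}"
  proof
    assume fin: "finite {j. H i n j}"
    obtain m1 where m1: "\<And>m. m \<ge> m1 \<Longrightarrow> finite {j. H i m j \<noteq> (j \<in> Z)}"
      using Z unfolding settles_def by blast
    obtain m2 where m2: "\<And>m. m > m2 \<Longrightarrow> delta (columns H m) L \<le> ereal (1 / 2 ^ Suc (i + 4))"
      using L unfolding delta_limit_def by blast
    \<comment> \<open>A comparison index that is close to \<open>L\<close> and whose column
      \<open>i\<close> has already settled.\<close>
    define m where "m = max m1 (Suc m2)"
    have "delta (columns H m) L \<le> ereal (1 / 2 ^ Suc (i + 4))" by (rule m2) (simp add: m_def)
    then obtain N' where N': "\<And>x. x \<ge> N' \<Longrightarrow> diff_count (columns H m) L x * 2 ^ (i + 4) \<le> x"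
      using eventually_diff_count by blast
    have "finite {j. H i m j \<noteq> (j \<in> Z)}" by (rule m1) (simp add: m_def)
    then have "infinite (Z - {j. H i m j \<noteq> (j \<in> Z)} - {j. H i n j})"
      using \<open>infinite Z\<close> fin by simp
    then obtain j where j: "j > max i (max N N')" "j \<in> Z - {j. H i m j \<noteq> (j \<in> Z)} - {j. H i n j}"
      unfolding infinite_nat_iff_unbounded by blast
    then have H: "H i m j" "\<not> H i n j" by auto
    define x :: nat where "x = 2 * 2 ^ j"
    have "j < 2 ^ j" by (rule less_exp)
    moreover have "N < j" "N' < j" using j(1) by auto
    ultimately have x: "x \<ge> N" "x \<ge> N'" unfolding x_def by linarith+
    have "block i j \<subseteq> {y. y < x \<and> (y \<in> columns H m \<and> y \<notin> columns H n \<or> y \<notin> columns H m \<and> y \<in> columns H n)}"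
      using H mem_columns[of _ i j H] by (auto simp: x_def block_def)
    then have "card (block i j) \<le> diff_count (columns H m) (columns H n) x"
      unfolding diff_count_def by (rule card_mono[rotated]) simp
    also have "\<dots> \<le> diff_count (columns H m) L x + diff_count (columns H n) L x"
      by (rule diff_count_triangle)
    finally have "card (block i j) * 2 ^ (i + 4) \<le>
        (diff_count (columns H m) L x + diff_count (columns H n) L x) * 2 ^ (i + 4)"
      by (rule mult_le_mono1)
    also have "\<dots> \<le> x + x" unfolding add_mult_distrib by (intro add_mono N' close x)
    \<comment> \<open>The exponent \<open>i + 4\<close> pays off here: \<open>card_block\<close>
      makes the left side at least \<open>8 * 2 ^ j\<close>.\<close>
    finally have "8 * (2 * 2 ^ i * card (block i j)) \<le> 4 * 2 ^ j"
      by (simp add: x_def power_add)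
    moreover have "2 ^ j \<le> 2 * 2 ^ i * card (block i j)" using j(1) by (intro card_block) simp
    moreover have "(0::nat) < 2 ^ j" by simp
    ultimately show False by linarith
  qed
\<comment> \<open>The other direction is the second clause of \<open>settles\<close>,
  contraposed.\<close>
qed (use Z in \<open>auto simp: settles_def\<close>)

section \<open>Decoding with the jump of a limit\<close>

lemma decidable_columns:
  assumes H: "decidable X (\<lambda>z. H (pi1 z) (pi1 (pi2 z)) (pi2 (pi2 z)))"
    and f: "computable X f" and g: "computable X g"
  shows "decidable X (\<lambda>x. f x \<in> columns H (g x))"
proof -
  have H': "decidable X (\<lambda>x. H (p x) (q x) (r x))"
    if "computable X p" "computable X q" "computable X r" for p q r
    using decidable_comp[OF H, of "\<lambda>x. pair (p x) (pair (q x) (r x))"] that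
    by (simp add: computable_pair)
  show ?thesis unfolding columns_def block_def mem_Collect_eq
    by (intro H' computable_intros computable_comp[OF f] computable_comp[OF g])
qed

text \<open>Searching for the index together with its threshold \<open>N\<close>, packed in
  \<open>w\<close>, leaves a universal condition over \<open>L\<close>, which \<open>jump L\<close>
  decides. Convergence makes the search succeed.\<close>

lemma computable_close_index:
  assumes H: "decidable {} (\<lambda>z. H (pi1 z) (pi1 (pi2 z)) (pi2 (pi2 z)))"
    and L: "delta_limit (columns H) L"
  obtains \<nu> where "computable (jump L) \<nu>"
    "\<And>i. \<exists>N. \<forall>x\<ge>N. diff_count (columns H (\<nu> i)) L x * 2 ^ (i + 4) \<le> x"
proof -
  define P where "P i w \<longleftrightarrow> (\<forall>x. pi2 w \<le> x \<longrightarrow> diff_count (columns H (pi1 w)) L x * 2 ^ (i + 4) \<le> x)" for i w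
  have "decidable (jump L) (\<lambda>z. P (pi1 z) (pi2 z))"
    unfolding P_def diff_count_def
    by (intro decidable_jump_all computable_intros computable_card decidable_oracle
        decidable_columns decidable_any_oracle[OF H])
  moreover have ex: "\<exists>w. P i w" for i
  proof -
    obtain m where "\<forall>n>m. delta (columns H n) L \<le> ereal (1 / 2 ^ Suc (i + 4))"
      using L unfolding delta_limit_def by blast
    then have "delta (columns H (Suc m)) L \<le> ereal (1 / 2 ^ Suc (i + 4))" by blast
    then obtain N where "\<And>x. x \<ge> N \<Longrightarrow> diff_count (columns H (Suc m)) L x * 2 ^ (i + 4) \<le> x"
      using eventually_diff_count by blast
    then have "P i (pair (Suc m) N)" by (simp add: P_def)
    then show ?thesis ..
  qed
  ultimately have "computable (jump L) (\<lambda>i. LEAST w. P i w)" by (rule computable_Least)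
  then have "computable (jump L) (\<lambda>i. pi1 (LEAST w. P i w))" by (rule computable_pi1)
  then show ?thesis
  proof (rule that)
    show "\<exists>N. \<forall>x\<ge>N. diff_count (columns H (pi1 (LEAST w. P i w))) L x * 2 ^ (i + 4) \<le> x" for i
      using LeastI_ex[OF ex[of i]] unfolding P_def by blast
  qed
qed

theorem theorem8p6:
  shows "\<exists>C :: nat \<Rightarrow> nat set. uniformly_computable C \<and> delta_Cauchy C \<and>
    (\<forall>L. delta_limit C L \<longrightarrow> jump (jump (jump {})) \<le>\<^sub>T jump L)"
proof -
  obtain M where M: "decidable {} (\<lambda>z. M (pi1 z) (pi1 (pi2 z)) (pi1 (pi2 (pi2 z))) (pi2 (pi2 (pi2 z))))"
    and third: "\<And>k. k \<in> jump (jump (jump {})) \<longleftrightarrow> (\<exists>a. \<forall>b. \<exists>c. M k a b c)"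
    by (rule third_jump_iff) (rule that)
  define G where "G k = guess (\<lambda>a. expansionary (M k a))" for k
  \<comment> \<open>Odd column \<open>2 * k + 1\<close> asks whether the approximation
    \<open>G (pi1 k) (pi2 k)\<close> is finite; the bound \<open>k \<le> i\<close> keeps the search
    bounded.\<close>
  define H where "H i n j \<longleftrightarrow> (\<exists>k\<le>i. i = 2 * k \<and> G k n j \<or>
      i = 2 * k + 1 \<and> (\<forall>b<j. n \<le> b \<longrightarrow> \<not> G (pi1 k) (pi2 k) b))" for i n j
  have M': "decidable {} (\<lambda>x. M (p x) (q x) (r x) (s x))"
    if "computable {} p" "computable {} q" "computable {} r" "computable {} s" for p q r s
    using decidable_comp[OF M, of "\<lambda>x. pair (p x) (pair (q x) (pair (r x) (s x)))"] that
    by (simp add: computable_pair)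
  have G: "decidable {} (\<lambda>z. G (pi1 z) (pi1 (pi2 z)) (pi2 (pi2 z)))"
    unfolding G_def guess_def expansionary_def by (intro computable_intros M')
  have G': "decidable X (\<lambda>x. G (p x) (q x) (r x))"
    if "computable X p" "computable X q" "computable X r" for X p q r
    using decidable_comp[OF decidable_any_oracle[OF G], of X "\<lambda>x. pair (p x) (pair (q x) (r x))"] that
    by (simp add: computable_pair)
  have H: "decidable {} (\<lambda>z. H (pi1 z) (pi1 (pi2 z)) (pi2 (pi2 z)))"
    unfolding H_def by (intro computable_intros G')
  have H_even: "H (2 * k) = G k" for k
    unfolding H_def by (intro ext iffI) (auto intro: exI[of _ k] dest: arg_cong[of _ _ even])
  have H_odd: "H (2 * k + 1) = (\<lambda>n j. \<forall>b<j. n \<le> b \<longrightarrow> \<not> G (pi1 k) (pi2 k) b)" for k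
    unfolding H_def by (intro ext iffI) (auto intro: exI[of _ k] dest: arg_cong[of _ _ even])
  \<comment> \<open>Candidate \<open>a\<close> acts infinitely often exactly if it witnesses the
    outer quantifier of \<open>third\<close>.\<close>
  have even: "\<exists>Z. settles (H (2 * k)) Z \<and> (infinite Z \<longleftrightarrow> k \<in> jump (jump (jump {})))" for k
    unfolding H_even third G_def infinite_expansionary[symmetric] by (rule settles_guess)
  have odd: "\<exists>Z. settles (H (2 * k + 1)) Z \<and> (infinite Z \<longleftrightarrow> finite {b. G (pi1 k) (pi2 k) b})" for k
    unfolding H_odd by (rule settles_quiet)
  have settles: "\<exists>Z. settles (H i) Z" for i
    using even odd by (cases "even i") (metis evenE, metis oddE)
  have "uniformly_computable (columns H)"
  proof -
    have "decidable {} (\<lambda>z. pi2 z \<in> columns H (pi1 z))"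
      by (intro decidable_columns[OF H] computable_intros)
    then obtain p where "\<And>z. run {} p z = Some (if pi2 z \<in> columns H (pi1 z) then 1 else 0)"
      by (auto simp: decidable_def computable_def)
    then have "run {} p (pair n x) = Some (if x \<in> columns H n then 1 else 0)" for n x by simp
    then show ?thesis unfolding uniformly_computable_def pair_def by blast
  qed
  moreover have "delta_Cauchy (columns H)" using settles by (rule delta_Cauchy_columns)
  moreover have "jump (jump (jump {})) \<le>\<^sub>T jump L" if L: "delta_limit (columns H) L" for L
  proof -
    obtain \<nu> where \<nu>: "computable (jump L) \<nu>"
      "\<And>i. \<exists>N. \<forall>x\<ge>N. diff_count (columns H (\<nu> i)) L x * 2 ^ (i + 4) \<le> x"
      by (rule computable_close_index[OF H L]) (rule that)
    have inf: "infinite {j. H i (\<nu> i) j} \<longleftrightarrow> infinite Z" if "settles (H i) Z" for i Z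
      using \<nu>(2)[of i] infinite_iff_of_close[OF that L] by blast
    \<comment> \<open>First \<open>\<nu> (2 * k)\<close> picks a reliable approximation to column
      \<open>2 * k\<close>; then \<open>\<mu> k\<close> is a reliable index for the odd column about
      that approximation.\<close>
    define \<mu> where "\<mu> k = \<nu> (2 * pair k (\<nu> (2 * k)) + 1)" for k
    have "k \<in> jump (jump (jump {})) \<longleftrightarrow> (\<exists>b. \<mu> k \<le> b \<and> G k (\<nu> (2 * k)) b)" for k
    proof -
      have "k \<in> jump (jump (jump {})) \<longleftrightarrow> infinite {b. G k (\<nu> (2 * k)) b}"
        using even[of k] inf[of "2 * k"] by (auto simp: H_even)
      also have "\<dots> \<longleftrightarrow> finite {j. \<forall>b<j. \<mu> k \<le> b \<longrightarrow> \<not> G k (\<nu> (2 * k)) b}"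
        using odd[of "pair k (\<nu> (2 * k))"] inf[of "2 * pair k (\<nu> (2 * k)) + 1"]
        unfolding H_odd pi_pair \<mu>_def by blast
      also have "\<dots> \<longleftrightarrow> (\<exists>b. \<mu> k \<le> b \<and> G k (\<nu> (2 * k)) b)"
        using infinite_quiet_iff[of "\<mu> k" "G k (\<nu> (2 * k))"] by blast
      finally show ?thesis .
    qed
    moreover have "decidable (jump L) (\<lambda>k. \<exists>b. \<mu> k \<le> b \<and> G k (\<nu> (2 * k)) b)"
    proof -
      \<comment> \<open>\<open>\<nu>\<close> and \<open>\<mu>\<close> are computable only in
        \<open>jump L\<close>, so they may not occur under the quantifier decided by the jump. It is
        decided with free parameters first, and their values are substituted afterwards.\<close>
      have "decidable (jump L) (\<lambda>z. \<exists>b. pi2 (pi2 z) \<le> b \<and> G (pi1 z) (pi1 (pi2 z)) b)"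
        by (intro decidable_jump_ex computable_intros G')
      moreover have "computable (jump L) (\<lambda>k. pair k (pair (\<nu> (2 * k)) (\<mu> k)))"
        unfolding \<mu>_def by (intro computable_intros computable_comp[OF \<nu>(1)])
      ultimately show ?thesis using decidable_comp by fastforce
    qed
    ultimately show ?thesis by (simp add: turing_le_def decidable_def computable_def)
  qed
  ultimately show ?thesis by blast
qed

end
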